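(* Let $H_{22}$ be the simply connected Lie group with Lie algebra $\mathfrak h_{22}$. For $s_0,s_2,s_5,s_8>0$ and $s_1,s_3,s_4,s_6,s_7\in\mathbb R$ let $$\sigma=\begin{pmatrix}1&0&0&0&0&0\\0&s_0&0&0&0&0\\0&0&1&0&0&0\\0&0&s_1&s_2&0&0\\0&0&s_3&s_4&s_5&0\\0&0&0&s_6&s_7&s_8\end{pmatrix}$$ and let $g_\sigma=\sigma^T\sigma$ be the corresponding left-invariant metric on $H_{22}$. Then $g_\sigma$ has nontrivial index of symmetry if and only if $s_1=s_3=0$. In this case, the index of symmetry is $1$ and the distribution of symmetry is generated by the left-invariant field $Y=e_3$. In particular, $\mathfrak s$ is properly contained in the central distribution of $H_{22}$ (the left-invariant distribution given by the center $Z(\mathfrak h_{22})$).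
   Context: $\mathfrak h_{22}$ is the 6-dimensional real Lie algebra with basis $e_1,\dots,e_6$ and nonzero brackets (up to skew-symmetry) $[e_1,e_2]=-e_4$, $[e_1,e_4]=-e_5$, $[e_1,e_5]=-e_6$, $[e_2,e_4]=-e_6$. The metric $g_\sigma$ is the left-invariant metric whose inner product on $\mathfrak h_{22}$ is $g_\sigma(e_i,e_j)=(\sigma^T\sigma)_{ij}$. For a left-invariant metric $g$ on this group the isotropy group of the isometry group is discrete, so every Killing field is right-invariant. For $X\in\mathfrak h$ let $X^*$ be the right-invariant field with $X^*_e=X_e$. The distribution of symmetry $\mathfrak s$ is the left-invariant distribution with $\mathfrak s_e=\{X_e: X\in\mathfrak h,\ (\nabla X^* )_e=0\}$, identified with a subspace $\mathfrak s\subset\mathfrak h$; equivalently, $Y\in\mathfrak s$ if and only if $g([X,Y],Z)+g([X,Z],Y)+g([Y,Z],X)=0$ for all $X,Z\in\mathfrak h$. The index of symmetry is $i_{\mathfrak s}(H,g)=\dim\mathfrak s$; it is nontrivial if it is positive. *)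

theory Defs
  imports "HOL-Analysis.Analysis"
begin

lemma UNIV_6: "(UNIV :: 6 set) = {1, 2, 3, 4, 5, 6}"
proof -
  have "card {1, 2, 3, 4, 5, 6 :: 6} = CARD(6)"
    by simp
  then show ?thesis
    by (metis card_subset_eq finite subset_UNIV)
qed

lemma forall_6: "(\<forall>i :: 6. P i) \<longleftrightarrow> P 1 \<and> P 2 \<and> P 3 \<and> P 4 \<and> P 5 \<and> P 6"
  by (metis UNIV_6 UNIV_I insertE singletonD)

lemma vector_6:
  "(vector [a, b, c, d, e, f] :: 'a::zero ^ 6) $ 1 = a"
  "(vector [a, b, c, d, e, f] :: 'a::zero ^ 6) $ 2 = b"
  "(vector [a, b, c, d, e, f] :: 'a::zero ^ 6) $ 3 = c"
  "(vector [a, b, c, d, e, f] :: 'a::zero ^ 6) $ 4 = d"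
  "(vector [a, b, c, d, e, f] :: 'a::zero ^ 6) $ 5 = e"
  "(vector [a, b, c, d, e, f] :: 'a::zero ^ 6) $ 6 = f"
  unfolding vector_def by simp_all


section \<open>The Lie algebra\<close>

abbreviation evec :: "6 \<Rightarrow> real ^ 6" where
  "evec i \<equiv> axis i 1"

definition h22_bracket :: "real ^ 6 \<Rightarrow> real ^ 6 \<Rightarrow> real ^ 6" where
  "h22_bracket x y =
     (x $ 1 * y $ 2 - x $ 2 * y $ 1) *\<^sub>R (- evec 4)
   + (x $ 1 * y $ 4 - x $ 4 * y $ 1) *\<^sub>R (- evec 5)
   + (x $ 1 * y $ 5 - x $ 5 * y $ 1) *\<^sub>R (- evec 6)
   + (x $ 2 * y $ 4 - x $ 4 * y $ 2) *\<^sub>R (- evec 6)"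

definition h22_center :: "(real ^ 6) set" where
  "h22_center = {x. \<forall>y. h22_bracket x y = 0}"

lemma h22_bracket_nth [simp]:
  "h22_bracket x y $ 1 = 0"
  "h22_bracket x y $ 2 = 0"
  "h22_bracket x y $ 3 = 0"
  "h22_bracket x y $ 4 = - (x $ 1 * y $ 2 - x $ 2 * y $ 1)"
  "h22_bracket x y $ 5 = - (x $ 1 * y $ 4 - x $ 4 * y $ 1)"
  "h22_bracket x y $ 6 = - (x $ 1 * y $ 5 - x $ 5 * y $ 1) - (x $ 2 * y $ 4 - x $ 4 * y $ 2)"
  by (simp_all add: h22_bracket_def axis_def)

lemma h22_bracket_basis:
  "h22_bracket (evec 1) (evec 2) = - evec 4"
  "h22_bracket (evec 1) (evec 4) = - evec 5"
  "h22_bracket (evec 1) (evec 5) = - evec 6"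
  "h22_bracket (evec 2) (evec 4) = - evec 6"
  by (simp_all add: vec_eq_iff forall_6) (simp_all add: axis_def)

lemma bilinear_h22_bracket: "bilinear h22_bracket"
  by (auto simp: bilinear_def vec_eq_iff forall_6 algebra_simps intro!: linearI)

lemma h22_bracket_skew: "h22_bracket x x = 0"
  by (simp add: vec_eq_iff forall_6)

lemma h22_jacobi:
  "h22_bracket x (h22_bracket y z) + h22_bracket y (h22_bracket z x)
     + h22_bracket z (h22_bracket x y) = 0"
  by (simp add: vec_eq_iff forall_6 algebra_simps)


section \<open>The simply connected Lie group\<close>

text \<open>
  The algebra is 4-step nilpotent, so its simply connected Lie group is the vector space
  itself with the Baker--Campbell--Hausdorff product, whose terms of degree at least 5
  vanish. The identity is 0, the inverse of \<open>x\<close> is \<open>- x\<close>, and the tangent space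
  at every point is identified with \<open>real ^ 6\<close>.
\<close>

definition H22_mult :: "real ^ 6 \<Rightarrow> real ^ 6 \<Rightarrow> real ^ 6" where
  "H22_mult x y =
     x + y + (1 / 2) *\<^sub>R h22_bracket x y
   + (1 / 12) *\<^sub>R (h22_bracket x (h22_bracket x y) + h22_bracket y (h22_bracket y x))
   - (1 / 24) *\<^sub>R h22_bracket y (h22_bracket x (h22_bracket x y))"

lemma H22_mult_nth:
  "H22_mult x y $ 1 = x $ 1 + y $ 1"
  "H22_mult x y $ 2 = x $ 2 + y $ 2"
  "H22_mult x y $ 3 = x $ 3 + y $ 3"
  "H22_mult x y $ 4 = x $ 4 + y $ 4 - (x $ 1 * y $ 2 - x $ 2 * y $ 1) / 2"
  "H22_mult x y $ 5 = x $ 5 + y $ 5 - (x $ 1 * y $ 4 - x $ 4 * y $ 1) / 2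
     + (x $ 1 - y $ 1) * (x $ 1 * y $ 2 - x $ 2 * y $ 1) / 12"
  "H22_mult x y $ 6 = x $ 6 + y $ 6
     - (x $ 1 * y $ 5 - x $ 5 * y $ 1) / 2 - (x $ 2 * y $ 4 - x $ 4 * y $ 2) / 2
     + (x $ 1 - y $ 1) * (x $ 1 * y $ 4 - x $ 4 * y $ 1) / 12
     + (x $ 2 - y $ 2) * (x $ 1 * y $ 2 - x $ 2 * y $ 1) / 12
     + x $ 1 * y $ 1 * (x $ 1 * y $ 2 - x $ 2 * y $ 1) / 24"
  unfolding H22_mult_def by (simp_all add: field_simps)

lemma H22_mult_group:
  "H22_mult (H22_mult x y) z = H22_mult x (H22_mult y z)"
  "H22_mult 0 x = x" "H22_mult x 0 = x"
  "H22_mult (- x) x = 0" "H22_mult x (- x) = 0"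
proof -
  show "H22_mult (H22_mult x y) z = H22_mult x (H22_mult y z)"
    unfolding vec_eq_iff forall_6 H22_mult_nth
    by (simp add: algebra_simps add_divide_distrib diff_divide_distrib)
qed (simp_all add: vec_eq_iff forall_6 H22_mult_nth)

definition dL :: "real ^ 6 \<Rightarrow> real ^ 6 \<Rightarrow> real ^ 6 \<Rightarrow> real ^ 6" where
  "dL a p = frechet_derivative (\<lambda>q. H22_mult a q) (at p)"

definition left_field :: "real ^ 6 \<Rightarrow> real ^ 6 \<Rightarrow> real ^ 6" where
  "left_field X p = dL p 0 X"

definition right_field :: "real ^ 6 \<Rightarrow> real ^ 6 \<Rightarrow> real ^ 6" where
  "right_field X p = frechet_derivative (\<lambda>q. H22_mult q p) (at 0) X"

definition left_distribution :: "(real ^ 6) set \<Rightarrow> real ^ 6 \<Rightarrow> (real ^ 6) set" where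
  "left_distribution W p = dL p 0 ` W"

definition left_metric ::
    "(real ^ 6 \<Rightarrow> real ^ 6 \<Rightarrow> real) \<Rightarrow> real ^ 6 \<Rightarrow> real ^ 6 \<Rightarrow> real ^ 6 \<Rightarrow> real" where
  "left_metric b p u v = b (dL (- p) p u) (dL (- p) p v)"

lemma has_derivative_h22_bracket [derivative_intros]:
  assumes "(f has_derivative f') (at p within S)" "(g has_derivative g') (at p within S)"
  shows "((\<lambda>q. h22_bracket (f q) (g q)) has_derivative
    (\<lambda>v. h22_bracket (f p) (g' v) + h22_bracket (f' v) (g p))) (at p within S)"
  using bounded_bilinear.FDERIV
    [OF bilinear_conv_bounded_bilinear[THEN iffD1, OF bilinear_h22_bracket] assms] .

lemma left_field_eq:
  "left_field X p = X + (1 / 2) *\<^sub>R h22_bracket p X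
     + (1 / 12) *\<^sub>R h22_bracket p (h22_bracket p X)"
proof -
  have "((\<lambda>q. H22_mult p q) has_derivative
      (\<lambda>X. X + (1 / 2) *\<^sub>R h22_bracket p X + (1 / 12) *\<^sub>R h22_bracket p (h22_bracket p X))) (at 0)"
    unfolding H22_mult_def
    by (rule has_derivative_eq_rhs, (rule derivative_intros)+)
      (simp add: fun_eq_iff vec_eq_iff forall_6)
  from frechet_derivative_at[OF this, symmetric] show ?thesis
    by (simp only: left_field_def dL_def)
qed

text \<open>The Lie algebra of left-invariant fields is the given one.\<close>

lemma left_field_bracket:
  "frechet_derivative (left_field Y) (at p) (left_field X p)
     - frechet_derivative (left_field X) (at p) (left_field Y p)
   = left_field (h22_bracket X Y) p"
proof -
  have *: "frechet_derivative (left_field X) (at p) =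
      (\<lambda>v. (1 / 2) *\<^sub>R h22_bracket v X + (1 / 12) *\<^sub>R (h22_bracket p (h22_bracket v X)
        + h22_bracket v (h22_bracket p X)))" for X
    unfolding left_field_eq[abs_def]
    by (rule frechet_derivative_at[symmetric], rule has_derivative_eq_rhs, (rule derivative_intros)+)
      (simp add: fun_eq_iff vec_eq_iff forall_6)
  show ?thesis
    unfolding * left_field_eq vec_eq_iff forall_6
    by (simp, simp add: algebra_simps add_divide_distrib diff_divide_distrib)
qed


section \<open>Levi-Civita connection in a global chart\<close>

text \<open>
  \<open>christoffel g p u v\<close> is \<open>u\<^sup>i v\<^sup>j \<Gamma>\<^sup>k\<^sub>i\<^sub>j(p) \<partial>\<^sub>k\<close>:
  the defining equation is the Koszul formula for the (commuting) constant fields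
  \<open>u\<close>, \<open>v\<close>, \<open>z\<close>.
\<close>

definition christoffel ::
    "('a::euclidean_space \<Rightarrow> 'a \<Rightarrow> 'a \<Rightarrow> real) \<Rightarrow> 'a \<Rightarrow> 'a \<Rightarrow> 'a \<Rightarrow> 'a" where
  "christoffel g p u v = (THE w. \<forall>z. 2 * g p w z =
       frechet_derivative (\<lambda>q. g q v z) (at p) u
     + frechet_derivative (\<lambda>q. g q u z) (at p) v
     - frechet_derivative (\<lambda>q. g q u v) (at p) z)"

text \<open>\<open>nabla g X p v\<close> is the value at \<open>p\<close> of the covariant derivative of the
  vector field \<open>X\<close> in the direction \<open>v\<close>.\<close>

definition nabla ::
    "('a::euclidean_space \<Rightarrow> 'a \<Rightarrow> 'a \<Rightarrow> real) \<Rightarrow> ('a \<Rightarrow> 'a) \<Rightarrow> 'a \<Rightarrow> 'a \<Rightarrow> 'a" where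
  "nabla g X p v = frechet_derivative X (at p) v + christoffel g p v (X p)"


section \<open>Symmetry\<close>

text \<open>
  The argument \<open>b\<close> is an inner product on the Lie algebra. Only right-invariant fields
  occur below because they are exactly the Killing fields of a left-invariant metric on this
  group (the isotropy group is discrete).
\<close>

definition symmetry_space :: "(real ^ 6 \<Rightarrow> real ^ 6 \<Rightarrow> real) \<Rightarrow> (real ^ 6) set" where
  "symmetry_space b = {right_field X 0 | X. \<forall>v. nabla (left_metric b) (right_field X) 0 v = 0}"

definition symmetry_distribution ::
    "(real ^ 6 \<Rightarrow> real ^ 6 \<Rightarrow> real) \<Rightarrow> real ^ 6 \<Rightarrow> (real ^ 6) set" where
  "symmetry_distribution b = left_distribution (symmetry_space b)"

definition index_of_symmetry :: "(real ^ 6 \<Rightarrow> real ^ 6 \<Rightarrow> real) \<Rightarrow> nat" where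
  "index_of_symmetry b = dim (symmetry_space b)"


section \<open>The family of metrics\<close>

definition sigma ::
    "real \<Rightarrow> real \<Rightarrow> real \<Rightarrow> real \<Rightarrow> real \<Rightarrow> real \<Rightarrow> real \<Rightarrow> real \<Rightarrow> real \<Rightarrow> real ^ 6 ^ 6" where
  "sigma s0 s1 s2 s3 s4 s5 s6 s7 s8 = vector
    [vector [1, 0,  0,  0,  0,  0],
     vector [0, s0, 0,  0,  0,  0],
     vector [0, 0,  1,  0,  0,  0],
     vector [0, 0,  s1, s2, 0,  0],
     vector [0, 0,  s3, s4, s5, 0],
     vector [0, 0,  0,  s6, s7, s8]]"

definition g_sigma :: "real ^ 6 ^ 6 \<Rightarrow> real ^ 6 \<Rightarrow> real ^ 6 \<Rightarrow> real" where
  "g_sigma S u v = u \<bullet> ((transpose S ** S) *v v)"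

end

theory Submission
  imports Defs
begin

text \<open>
  At the identity the covariant derivative of a right-invariant field is a purely algebraic
  expression in the bracket and the inner product \<open>b\<close>: the derivative of the left-invariant
  metric at \<open>0\<close> comes from the first-order term \<open>u - [p, u] / 2\<close> of the left Maurer--Cartan
  form, the derivative of the right-invariant field \<open>Y\<^sup>*\<close> is \<open>[Y, v] / 2\<close>, and the Koszul
  formula combines them into
  \<open>2 b (\<nabla>\<^sub>v Y\<^sup>*) z = - (b [v, Y] z + b [v, z] Y + b [Y, z] v)\<close>.
  Nondegeneracy of \<open>b\<close> turns this into the linear condition on \<open>Y\<close> of
  \<open>mem_symmetry_space_iff\<close>.

  For the metrics \<open>g\<^sub>\<sigma>\<close> that condition is tested first with the central vector
  \<open>z = e\<^sub>6\<close>. Two of its terms vanish and what remains, \<open>[v, Y] \<bottom> e\<^sub>6\<close> for all \<open>v\<close>, is a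
  triangular system forcing \<open>Y\<close> into the center \<open>span {e\<^sub>3, e\<^sub>6}\<close>
  (\<open>symmetric_vector_central\<close>). For central \<open>Y\<close> only \<open>b [v, z] Y = 0\<close> is left, that is, \<open>Y\<close>
  is orthogonal to the derived algebra \<open>span {e\<^sub>4, e\<^sub>5, e\<^sub>6}\<close>. Since \<open>e\<^sub>3 \<bottom> e\<^sub>6\<close>, the
  \<open>e\<^sub>6\<close>-component of \<open>Y\<close> vanishes, and \<open>e\<^sub>3\<close> itself is orthogonal to \<open>e\<^sub>4\<close> and \<open>e\<^sub>5\<close> exactly
  when \<open>s1 = s3 = 0\<close>. Finally, left-invariant fields given by central vectors are constant in
  the exponential chart, so the distributions can be read off at the identity.
\<close>

section \<open>Positive definite bilinear forms\<close>

definition inner_product_form :: "('a::euclidean_space \<Rightarrow> 'a \<Rightarrow> real) \<Rightarrow> bool" where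
  "inner_product_form b \<longleftrightarrow>
     bilinear b \<and> (\<forall>x y. b x y = b y x) \<and> (\<forall>x. x \<noteq> 0 \<longrightarrow> b x x > 0)"

lemma inner_product_form_nondegenerate:
  assumes "inner_product_form b" and "\<And>z. b w z = b w' z"
  shows "w = w'"
proof -
  have "b (w - w') (w - w') = 0"
    using assms(1) bilinear_lsub[of b w w' "w - w'"] assms(2)[of "w - w'"]
    by (simp add: inner_product_form_def)
  then show ?thesis
    using assms(1) unfolding inner_product_form_def by (metis eq_iff_diff_eq_0 less_irrefl)
qed

text \<open>
  Sending \<open>w\<close> to the Euclidean gradient of \<open>b w\<close> is an injective linear endomorphism, hence
  surjective.
\<close>

lemma inner_product_form_represents:
  fixes b :: "'a::euclidean_space \<Rightarrow> 'a \<Rightarrow> real"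
  assumes b: "inner_product_form b" and L: "linear L"
  obtains w where "\<And>z. b w z = L z"
proof -
  have bil: "bilinear b"
    using b by (simp add: inner_product_form_def)
  define T where "T w = (\<Sum>i\<in>Basis. b w i *\<^sub>R i)" for w
  have T_inner: "T w \<bullet> z = b w z" for w z
  proof -
    have "b w z = b w (\<Sum>i\<in>Basis. (z \<bullet> i) *\<^sub>R i)"
      by (simp add: euclidean_representation)
    also have "\<dots> = (\<Sum>i\<in>Basis. (z \<bullet> i) * b w i)"
      using bil by (simp add: bilinear_def linear_sum linear_cmul)
    finally show ?thesis
      unfolding T_def inner_sum_left by (simp add: mult.commute inner_commute)
  qed
  have "linear T"
    by (rule linearI)
      (simp_all add: T_def bilinear_ladd[OF bil] bilinear_lmul[OF bil] scaleR_left_distrib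
        sum.distrib scaleR_sum_right)
  moreover have "inj T"
    using inner_product_form_nondegenerate[OF b] by (metis T_inner injI)
  ultimately have "surj T"
    by (rule linear_inj_imp_surj)
  then obtain w where w: "T w = (\<Sum>i\<in>Basis. L i *\<^sub>R i)"
    by (metis surjD)
  have "b w z = L z" for z
  proof -
    have "L z = L (\<Sum>i\<in>Basis. (z \<bullet> i) *\<^sub>R i)"
      by (simp add: euclidean_representation)
    also have "\<dots> = (\<Sum>i\<in>Basis. (z \<bullet> i) * L i)"
      using L by (simp add: linear_sum linear_cmul)
    also have "\<dots> = T w \<bullet> z"
      unfolding w inner_sum_left by (simp add: mult.commute inner_commute)
    finally show ?thesis
      by (simp add: T_inner)
  qed
  then show thesis
    by (rule that)
qed


section \<open>Invariant fields and metrics at the identity\<close>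

text \<open>
  The left Maurer--Cartan form in the exponential chart, \<open>(1 - exp (- ad p)) / ad p\<close>; the
  power series stops after the cubic term because the algebra is 4-step nilpotent.
\<close>

lemma dL_minus_self:
  "dL (- p) p u = u - (1 / 2) *\<^sub>R h22_bracket p u
     + (1 / 6) *\<^sub>R h22_bracket p (h22_bracket p u)
     - (1 / 24) *\<^sub>R h22_bracket p (h22_bracket p (h22_bracket p u))"
proof -
  have "((\<lambda>q. H22_mult (- p) q) has_derivative
      (\<lambda>u. u - (1 / 2) *\<^sub>R h22_bracket p u
     + (1 / 6) *\<^sub>R h22_bracket p (h22_bracket p u)
     - (1 / 24) *\<^sub>R h22_bracket p (h22_bracket p (h22_bracket p u)))) (at p)"
    unfolding H22_mult_def
    by (rule has_derivative_eq_rhs, (rule derivative_intros)+)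
      (simp add: fun_eq_iff vec_eq_iff forall_6, simp add: field_simps)
  from frechet_derivative_at[OF this, symmetric] show ?thesis
    by (simp only: dL_def)
qed

lemma right_field_eq:
  "right_field X p = X + (1 / 2) *\<^sub>R h22_bracket X p
     + (1 / 12) *\<^sub>R h22_bracket p (h22_bracket p X)"
proof -
  have "((\<lambda>q. H22_mult q p) has_derivative
      (\<lambda>X. X + (1 / 2) *\<^sub>R h22_bracket X p
        + (1 / 12) *\<^sub>R h22_bracket p (h22_bracket p X))) (at 0)"
    unfolding H22_mult_def
    by (rule has_derivative_eq_rhs, (rule derivative_intros)+)
      (simp add: fun_eq_iff vec_eq_iff forall_6)
  from frechet_derivative_at[OF this, symmetric] show ?thesis
    by (simp only: right_field_def)
qed

lemma right_field_0: "right_field X 0 = X"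
  by (simp add: right_field_eq vec_eq_iff forall_6)

lemma frechet_derivative_right_field_0:
  "frechet_derivative (right_field X) (at 0) = (\<lambda>v. (1 / 2) *\<^sub>R h22_bracket X v)"
  unfolding right_field_eq[abs_def]
  by (rule frechet_derivative_at[symmetric], rule has_derivative_eq_rhs,
      (rule derivative_intros)+) (simp add: fun_eq_iff vec_eq_iff forall_6)

lemma left_metric_0: "left_metric b 0 u v = b u v"
proof -
  have "dL (- 0) 0 u = u" for u
    unfolding dL_minus_self by (simp add: vec_eq_iff forall_6)
  then show ?thesis
    by (simp add: left_metric_def)
qed

lemma frechet_derivative_left_metric_0:
  assumes "bilinear b"
  shows "frechet_derivative (\<lambda>q. left_metric b q u v) (at 0) =
    (\<lambda>h. - (b (h22_bracket h u) v + b u (h22_bracket h v)) / 2)"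
proof -
  have dL: "((\<lambda>q. dL (- q) q u) has_derivative (\<lambda>h. - (1 / 2) *\<^sub>R h22_bracket h u)) (at 0)"
    for u
    unfolding dL_minus_self
    by (rule has_derivative_eq_rhs, (rule derivative_intros)+)
      (simp add: fun_eq_iff vec_eq_iff forall_6)
  have dL0: "dL (- 0) 0 u = u" for u
    unfolding dL_minus_self by (simp add: vec_eq_iff forall_6)
  have "((\<lambda>q. left_metric b q u v) has_derivative
      (\<lambda>h. b (dL (- 0) 0 u) (- (1 / 2) *\<^sub>R h22_bracket h v)
         + b (- (1 / 2) *\<^sub>R h22_bracket h u) (dL (- 0) 0 v))) (at 0)"
    unfolding left_metric_def
    by (rule bounded_bilinear.FDERIV
        [OF bilinear_conv_bounded_bilinear[THEN iffD1, OF assms] dL dL])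
  from frechet_derivative_at[OF this, symmetric] show ?thesis
    unfolding dL0 bilinear_lmul[OF assms] bilinear_rmul[OF assms]
    by (simp add: fun_eq_iff field_simps)
qed

text \<open>
  In the Koszul sum of the derivatives of the metric at \<open>0\<close> the terms containing \<open>[u, v]\<close>
  cancel by skew-symmetry, and those containing \<open>[u, z]\<close> or \<open>[v, z]\<close> add up.
\<close>

lemma christoffel_left_metric_0:
  assumes b: "inner_product_form b"
  shows "2 * b (christoffel (left_metric b) 0 u v) z =
    - b v (h22_bracket u z) - b u (h22_bracket v z)"
proof -
  have bil: "bilinear b" and sym: "b x y = b y x" for x y
    using b by (auto simp: inner_product_form_def)
  have skew: "h22_bracket x y = - h22_bracket y x" for x y
    by (simp add: vec_eq_iff forall_6)
  have koszul: "frechet_derivative (\<lambda>q. left_metric b q v z) (at 0) u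
     + frechet_derivative (\<lambda>q. left_metric b q u z) (at 0) v
     - frechet_derivative (\<lambda>q. left_metric b q u v) (at 0) z
     = - b v (h22_bracket u z) - b u (h22_bracket v z)" for z
    unfolding frechet_derivative_left_metric_0[OF bil]
    using skew[of z u] skew[of z v] skew[of v u] sym[of "h22_bracket u z" v]
    by (simp add: bilinear_lneg[OF bil] bilinear_rneg[OF bil] field_simps)
  have "linear (\<lambda>z. (- b v (h22_bracket u z) - b u (h22_bracket v z)) / 2)"
    by (rule linearI)
      (simp_all add: bilinear_radd[OF bil] bilinear_rmul[OF bil]
        bilinear_radd[OF bilinear_h22_bracket] bilinear_rmul[OF bilinear_h22_bracket]
        field_simps)
  from inner_product_form_represents[OF b this] obtain w where
    w: "b w z = (- b v (h22_bracket u z) - b u (h22_bracket v z)) / 2" for z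
    by blast
  have "christoffel (left_metric b) 0 u v = w"
    unfolding christoffel_def koszul left_metric_0
  proof (rule the_equality)
    show "\<forall>z. 2 * b w z = - b v (h22_bracket u z) - b u (h22_bracket v z)"
      by (simp add: w)
  next
    fix w' assume "\<forall>z. 2 * b w' z = - b v (h22_bracket u z) - b u (h22_bracket v z)"
    then have "b w' z = b w z" for z
      by (simp add: w field_simps)
    then show "w' = w"
      by (rule inner_product_form_nondegenerate[OF b])
  qed
  then show ?thesis
    by (simp add: w)
qed

text \<open>
  The right-hand side is the vanishing of \<open>- 2 b (\<nabla>\<^sub>v Y\<^sup>*) z\<close> for all \<open>v\<close> and \<open>z\<close>.
\<close>

lemma mem_symmetry_space_iff:
  assumes b: "inner_product_form b"
  shows "Y \<in> symmetry_space b \<longleftrightarrow>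
    (\<forall>v z. b (h22_bracket v Y) z + b (h22_bracket v z) Y + b (h22_bracket Y z) v = 0)"
proof -
  have bil: "bilinear b" and sym: "b x y = b y x" for x y
    using b by (auto simp: inner_product_form_def)
  have skew: "h22_bracket Y v = - h22_bracket v Y" for v
    by (simp add: vec_eq_iff forall_6)
  let ?N = "nabla (left_metric b) (right_field Y) 0"
  have N: "2 * b (?N v) z =
      - (b (h22_bracket v Y) z + b (h22_bracket v z) Y + b (h22_bracket Y z) v)" for v z
    unfolding nabla_def frechet_derivative_right_field_0 right_field_0
      bilinear_ladd[OF bil] bilinear_lmul[OF bil] distrib_left christoffel_left_metric_0[OF b]
    using sym[of "h22_bracket v z" Y] sym[of "h22_bracket Y z" v] skew[of v]
    by (simp add: bilinear_lneg[OF bil])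
  have "?N v = 0 \<longleftrightarrow> (\<forall>z. b (?N v) z = 0)" for v
    using inner_product_form_nondegenerate[OF b, of "?N v" 0] bilinear_lzero[OF bil] by auto
  moreover have "b (?N v) z = 0 \<longleftrightarrow>
      b (h22_bracket v Y) z + b (h22_bracket v z) Y + b (h22_bracket Y z) v = 0" for v z
    using N[of v z] by linarith
  ultimately show ?thesis
    by (simp add: symmetry_space_def right_field_0)
qed


section \<open>Central distributions\<close>

lemma h22_center_eq: "h22_center = span {evec 3, evec 6}"
proof (intro equalityI subsetI)
  fix x assume "x \<in> h22_center"
  then have c: "h22_bracket x y = 0" for y
    by (simp add: h22_center_def)
  have "x $ 1 = 0" "x $ 2 = 0" "x $ 4 = 0" "x $ 5 = 0"
    using c[of "evec 1"] c[of "evec 2"] c[of "evec 5"]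
    by (simp_all add: vec_eq_iff forall_6) (simp_all add: axis_def)
  then have "x = (x $ 3) *\<^sub>R evec 3 + (x $ 6) *\<^sub>R evec 6"
    by (simp add: vec_eq_iff forall_6) (simp add: axis_def)
  then show "x \<in> span {evec 3, evec 6}"
    by (metis insertI1 insertI2 span_add span_base span_scale)
next
  fix x :: "real ^ 6" assume "x \<in> span {evec 3, evec 6}"
  then obtain k m where "x = k *\<^sub>R evec 3 + m *\<^sub>R evec 6"
    by (auto simp: span_insert algebra_simps)
  then have "x $ 1 = 0" "x $ 2 = 0" "x $ 4 = 0" "x $ 5 = 0"
    by (simp_all add: axis_def)
  then show "x \<in> h22_center"
    by (simp add: h22_center_def vec_eq_iff forall_6)
qed

text \<open>
  In the exponential chart the differential of a left translation at the identity differs from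
  the identity map only by brackets.
\<close>

lemma left_field_central:
  assumes "X \<in> h22_center"
  shows "left_field X p = X"
proof -
  have "h22_bracket p X = - h22_bracket X p"
    by (simp add: vec_eq_iff forall_6)
  then have "h22_bracket p X = 0"
    using assms by (simp add: h22_center_def)
  moreover have "h22_bracket p 0 = 0"
    by (simp add: vec_eq_iff forall_6)
  ultimately show ?thesis
    by (simp add: left_field_eq)
qed

lemma left_distribution_central:
  assumes "W \<subseteq> h22_center"
  shows "left_distribution W p = W"
  using assms left_field_central[of _ p]
  by (force simp: left_distribution_def left_field_def image_iff)


section \<open>The distribution of symmetry of the metrics of the family\<close>

lemma g_sigma_eq_inner: "g_sigma S u v = (S *v u) \<bullet> (S *v v)"
  using dot_lmul_matrix[of u "transpose S" "S *v v"]
  by (simp only: g_sigma_def matrix_vector_mul_assoc vector_transpose_matrix)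

lemma sum_6: "sum f (UNIV :: 6 set) = f 1 + f 2 + f 3 + f 4 + f 5 + f 6"
  unfolding UNIV_6 by (simp add: ac_simps)

lemma sigma_mult_vec:
  "(sigma s0 s1 s2 s3 s4 s5 s6 s7 s8 *v x) $ 1 = x $ 1"
  "(sigma s0 s1 s2 s3 s4 s5 s6 s7 s8 *v x) $ 2 = s0 * x $ 2"
  "(sigma s0 s1 s2 s3 s4 s5 s6 s7 s8 *v x) $ 3 = x $ 3"
  "(sigma s0 s1 s2 s3 s4 s5 s6 s7 s8 *v x) $ 4 = s1 * x $ 3 + s2 * x $ 4"
  "(sigma s0 s1 s2 s3 s4 s5 s6 s7 s8 *v x) $ 5 = s3 * x $ 3 + s4 * x $ 4 + s5 * x $ 5"
  "(sigma s0 s1 s2 s3 s4 s5 s6 s7 s8 *v x) $ 6 = s6 * x $ 4 + s7 * x $ 5 + s8 * x $ 6"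
  by (simp_all add: matrix_vector_mult_def sum_6 sigma_def vector_6)

lemma inner_6: "(x :: real ^ 6) \<bullet> y =
  x $ 1 * y $ 1 + x $ 2 * y $ 2 + x $ 3 * y $ 3 + x $ 4 * y $ 4 + x $ 5 * y $ 5 + x $ 6 * y $ 6"
  by (simp add: inner_vec_def sum_6)

lemma inner_product_form_g_sigma:
  assumes "s0 > 0" "s2 > 0" "s5 > 0" "s8 > 0"
  shows "inner_product_form (g_sigma (sigma s0 s1 s2 s3 s4 s5 s6 s7 s8))"
proof -
  let ?S = "sigma s0 s1 s2 s3 s4 s5 s6 s7 s8"
  have "x = 0" if "?S *v x = 0" for x
  proof -
    have z: "(?S *v x) $ i = 0" for i
      using that by simp
    show ?thesis
      using z[of 1] z[of 2] z[of 3] z[of 4] z[of 5] z[of 6] assms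
      by (simp add: sigma_mult_vec vec_eq_iff forall_6)
  qed
  then show ?thesis
    by (auto simp: inner_product_form_def g_sigma_eq_inner bilinear_def inner_commute
        matrix_vector_right_distrib inner_add_left inner_add_right
        matrix_vector_mult_scaleR intro!: linearI)
qed

lemmas g_sigma_simps = g_sigma_eq_inner inner_6 sigma_mult_vec

text \<open>
  Pairing with the central vector \<open>e\<^sub>6\<close> leaves only \<open>g [v, Y] e\<^sub>6 = 0\<close>. Taking \<open>v\<close> to be
  \<open>e\<^sub>5\<close>, \<open>e\<^sub>4\<close>, \<open>e\<^sub>2\<close>, \<open>e\<^sub>1\<close> in this order eliminates the components \<open>1\<close>, \<open>2\<close>, \<open>4\<close>, \<open>5\<close> of
  \<open>Y\<close> one after the other.
\<close>

lemma symmetric_vector_central: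
  assumes "s8 > 0"
    and Y: "\<And>v z. g_sigma (sigma s0 s1 s2 s3 s4 s5 s6 s7 s8) (h22_bracket v Y) z
      + g_sigma (sigma s0 s1 s2 s3 s4 s5 s6 s7 s8) (h22_bracket v z) Y
      + g_sigma (sigma s0 s1 s2 s3 s4 s5 s6 s7 s8) (h22_bracket Y z) v = 0"
  shows "Y $ 1 = 0" "Y $ 2 = 0" "Y $ 4 = 0" "Y $ 5 = 0"
proof -
  show 1: "Y $ 1 = 0"
    using Y[of "evec 5" "evec 6"] assms(1) by (simp add: g_sigma_simps) (simp add: axis_def)
  show 2: "Y $ 2 = 0"
    using Y[of "evec 4" "evec 6"] assms(1) 1 by (simp add: g_sigma_simps) (simp add: axis_def)
  show 4: "Y $ 4 = 0"
    using Y[of "evec 2" "evec 6"] assms(1) 1 2 by (simp add: g_sigma_simps) (simp add: axis_def)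
  show "Y $ 5 = 0"
    using Y[of "evec 1" "evec 6"] assms(1) 1 2 4 by (simp add: g_sigma_simps) (simp add: axis_def)
qed

lemma symmetry_space_g_sigma:
  assumes s: "s0 > 0" "s2 > 0" "s5 > 0" "s8 > 0"
  shows "symmetry_space (g_sigma (sigma s0 s1 s2 s3 s4 s5 s6 s7 s8)) =
    (if s1 = 0 \<and> s3 = 0 then span {evec 3} else {0})"
proof -
  let ?g = "g_sigma (sigma s0 s1 s2 s3 s4 s5 s6 s7 s8)"
  let ?sym = "\<lambda>Y. \<forall>v z. ?g (h22_bracket v Y) z + ?g (h22_bracket v z) Y
      + ?g (h22_bracket Y z) v = 0"
  have multiple: "Y = (Y $ 3) *\<^sub>R evec 3 \<and> (Y $ 3 = 0 \<or> s1 = 0 \<and> s3 = 0)" if "?sym Y" for Y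
  proof -
    have Y: "?g (h22_bracket v Y) z + ?g (h22_bracket v z) Y + ?g (h22_bracket Y z) v = 0"
      for v z
      using that by blast
    note c = symmetric_vector_central[OF s(4) Y]
    \<comment> \<open>The brackets \<open>[e\<^sub>1, e\<^sub>5]\<close>, \<open>[e\<^sub>1, e\<^sub>4]\<close>, \<open>[e\<^sub>1, e\<^sub>2]\<close> span the derived algebra,
      to which \<open>Y\<close> is orthogonal.\<close>
    have 6: "Y $ 6 = 0"
      using Y[of "evec 1" "evec 5"] s c by (simp add: g_sigma_simps) (simp add: axis_def)
    have 3: "Y $ 3 = 0 \<or> s3 = 0"
      using Y[of "evec 1" "evec 4"] s c 6 by (simp add: g_sigma_simps) (auto simp: axis_def)
    have "Y $ 3 = 0 \<or> s1 = 0"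
      using Y[of "evec 1" "evec 2"] s c 6 3 by (simp add: g_sigma_simps) (auto simp: axis_def)
    moreover have "Y = (Y $ 3) *\<^sub>R evec 3"
      using c 6 by (simp add: vec_eq_iff forall_6) (simp add: axis_def)
    ultimately show ?thesis
      using 3 by blast
  qed
  have "?sym (k *\<^sub>R evec 3)" if "s1 = 0 \<and> s3 = 0" for k
    using that by (simp add: g_sigma_simps) (simp add: axis_def)
  moreover have "?sym 0"
    by (simp add: g_sigma_simps)
  ultimately have "?sym Y \<longleftrightarrow> Y \<in> (if s1 = 0 \<and> s3 = 0 then span {evec 3} else {0})" for Y
    using multiple[of Y] by (cases "s1 = 0 \<and> s3 = 0") (auto simp: span_singleton)
  then show ?thesis
    using mem_symmetry_space_iff[OF inner_product_form_g_sigma[OF s]] by blast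
qed

theorem theorem6p3:
  fixes s0 s1 s2 s3 s4 s5 s6 s7 s8 :: real
  assumes "s0 > 0" and "s2 > 0" and "s5 > 0" and "s8 > 0"
  defines "g \<equiv> g_sigma (sigma s0 s1 s2 s3 s4 s5 s6 s7 s8)"
  shows "(index_of_symmetry g > 0 \<longleftrightarrow> s1 = 0 \<and> s3 = 0) \<and>
    (s1 = 0 \<and> s3 = 0 \<longrightarrow>
      index_of_symmetry g = 1 \<and>
      (\<forall>p. symmetry_distribution g p = span {left_field (evec 3) p}) \<and>
      (\<forall>p. symmetry_distribution g p \<subset> left_distribution h22_center p))"
proof -
  have space: "symmetry_space g = (if s1 = 0 \<and> s3 = 0 then span {evec 3} else {0})"
    unfolding g_def using assms(1-4) by (rule symmetry_space_g_sigma)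
  have "evec 3 \<noteq> (0 :: real ^ 6)"
    by (simp add: axis_eq_0_iff)
  then have "dim {evec 3 :: real ^ 6} = 1"
    by (simp add: dim_eq_card_independent)
  then have index: "index_of_symmetry g = (if s1 = 0 \<and> s3 = 0 then 1 else 0)"
    by (simp add: index_of_symmetry_def space)
  have sub: "span {evec 3} \<subseteq> h22_center"
    unfolding h22_center_eq by (rule span_mono) simp
  have "evec 3 \<in> h22_center"
    using sub span_base by blast
  note e3 = left_field_central[OF this]
  have "evec 6 \<notin> span {evec 3 :: real ^ 6}"
  proof
    assume "evec 6 \<in> span {evec 3 :: real ^ 6}"
    then obtain k where "evec 6 = k *\<^sub>R (evec 3 :: real ^ 6)"
      by (auto simp: span_singleton)
    then have "evec 6 $ 6 = (k *\<^sub>R (evec 3 :: real ^ 6)) $ 6"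
      by (rule arg_cong)
    then show False
      by (simp add: axis_def)
  qed
  moreover have "evec 6 \<in> h22_center"
    unfolding h22_center_eq by (simp add: span_base)
  ultimately have psub: "span {evec 3} \<subset> h22_center"
    using sub by blast
  show ?thesis
    using psub by (simp add: index symmetry_distribution_def space e3
        left_distribution_central[OF sub] left_distribution_central[OF order_refl])
qed

end
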